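(* Let $a,b,r$ be integers with $r\ge1$ and $b\ge a\ge 1$, and let $G$ be a connected graph of order $n\ge4(a+b+r+1)$ with minimum degree $\delta(G)\ge a+r$. If $$e(G)\ge \binom{n-r-b-1}{2}+r(n-r)+a(b+1)+a,$$ then $G$ is fractional $ID$-$[a,b]$-factor-critical (with respect to $r$).
   Context: All graphs are finite, simple and undirected. $e(G)$ denotes the number of edges of $G$. For positive integers $a\le b$, a graph $G$ has a fractional $[a,b]$-factor if there is a function $h: E(G)\to[0,1]$ such that $a\le \sum_{e\ni v} h(e)\le b$ for every $v\in V(G)$ (the sum is over edges incident with $v$). For an integer $r\ge 1$, $G$ is fractional $ID$-$[a,b]$-factor-critical (with respect to $r$) if for every independent set $I$ of $G$ with $|I|=r$, the graph $G-I$ has a fractional $[a,b]$-factor. *)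

theory Defs
  imports Complex_Main
begin

text \<open>A graph is given by its vertex set \<open>V\<close> and its edge set \<open>E\<close>; an edge is the
  two-element set of its ends.\<close>

definition fin_simple_graph :: "'a set \<Rightarrow> 'a set set \<Rightarrow> bool" where
  "fin_simple_graph V E \<longleftrightarrow> finite V \<and> (\<forall>e\<in>E. e \<subseteq> V \<and> card e = 2)"

definition connected_graph :: "'a set \<Rightarrow> 'a set set \<Rightarrow> bool" where
  "connected_graph V E \<longleftrightarrow>
     V \<noteq> {} \<and> (\<forall>u\<in>V. \<forall>v\<in>V. (u, v) \<in> {(x, y). {x, y} \<in> E}\<^sup>*)"

definition degree :: "'a set set \<Rightarrow> 'a \<Rightarrow> nat" where
  "degree E v = card {e \<in> E. v \<in> e}"

text \<open>Only meaningful for finite nonempty \<open>V\<close>.\<close>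

definition min_degree :: "'a set \<Rightarrow> 'a set set \<Rightarrow> nat" where
  "min_degree V E = Min (degree E ` V)"

definition independent_set :: "'a set \<Rightarrow> 'a set set \<Rightarrow> 'a set \<Rightarrow> bool" where
  "independent_set V E I \<longleftrightarrow> I \<subseteq> V \<and> (\<forall>x\<in>I. \<forall>y\<in>I. {x, y} \<notin> E)"

text \<open>Edge set of \<open>G - I\<close>, whose vertex set is \<open>V - I\<close>.\<close>

definition delete_edges :: "'a set set \<Rightarrow> 'a set \<Rightarrow> 'a set set" where
  "delete_edges E I = {e \<in> E. e \<inter> I = {}}"

lemma fin_simple_graph_delete:
  "fin_simple_graph V E \<Longrightarrow> fin_simple_graph (V - I) (delete_edges E I)"
  unfolding fin_simple_graph_def delete_edges_def by auto

definition has_fractional_factor :: "nat \<Rightarrow> nat \<Rightarrow> 'a set \<Rightarrow> 'a set set \<Rightarrow> bool" where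
  "has_fractional_factor a b V E \<longleftrightarrow>
     (\<exists>h :: 'a set \<Rightarrow> real.
        (\<forall>e\<in>E. 0 \<le> h e \<and> h e \<le> 1) \<and>
        (\<forall>v\<in>V. real a \<le> (\<Sum>e\<in>{e \<in> E. v \<in> e}. h e) \<and>
               (\<Sum>e\<in>{e \<in> E. v \<in> e}. h e) \<le> real b))"

definition fractional_ID_factor_critical ::
  "nat \<Rightarrow> nat \<Rightarrow> nat \<Rightarrow> 'a set \<Rightarrow> 'a set set \<Rightarrow> bool" where
  "fractional_ID_factor_critical r a b V E \<longleftrightarrow>
     (\<forall>I. independent_set V E I \<and> card I = r \<longrightarrow>
        has_fractional_factor a b (V - I) (delete_edges E I))"

end

theory Submission
  imports Defs "HOL-Analysis.Function_Topology"
begin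

text \<open>Deleting the independent set \<open>I\<close> costs at most \<open>r(n - r)\<close> edges and lowers each degree by at
  most \<open>r\<close>, so \<open>G - I\<close> has order \<open>m = n - r\<close>, minimum degree at least \<open>a\<close> and at least
  \<open>C(m - b - 1, 2) + a(b + 1) + a\<close> edges. If it had no fractional \<open>[a,b]\<close>-factor, Anstee's criterion
  would give disjoint \<open>S, T\<close> of sizes \<open>s, t\<close> for which the sum \<open>D\<close> of the degrees of the vertices of
  \<open>T\<close> in \<open>G - I - S\<close> satisfies \<open>D < at - bs\<close>. The minimum degree gives \<open>D \<ge> t(a - s)\<close>, which
  forces \<open>t \<ge> b + 1\<close>; but then the number of edges, at most \<open>C(m - t, 2) + st + D\<close>, is too small.

  Sufficiency of Anstee's criterion comes from a weighting with loads at most \<open>b\<close> that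
  maximises \<open>\<Sum>v. min a (load v)\<close>: if some vertex \<open>u\<close> has load below \<open>a\<close>, the vertices to which
  residual directions can shift the deficiency of \<open>u\<close> violate the criterion.\<close>

section \<open>Loads and degrees as sums over vertices\<close>

definition load :: "'a set set \<Rightarrow> ('a set \<Rightarrow> real) \<Rightarrow> 'a \<Rightarrow> real" where
  "load E h v = (\<Sum>e\<in>{e \<in> E. v \<in> e}. h e)"

lemma fin_simple_graph_finite_edges:
  assumes "fin_simple_graph V E" shows "finite E"
proof -
  have "E \<subseteq> Pow V" "finite V" using assms by (auto simp: fin_simple_graph_def)
  then show ?thesis by (meson finite_Pow_iff finite_subset)
qed

lemma sum_incident_edges:
  assumes "fin_simple_graph V E" "v \<in> V"
  shows "(\<Sum>e\<in>{e \<in> E. v \<in> e}. f e) = (\<Sum>y\<in>{y \<in> V. {v, y} \<in> E}. f {v, y})"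
proof -
  have "bij_betw (\<lambda>y. {v, y}) {y \<in> V. {v, y} \<in> E} {e \<in> E. v \<in> e}"
  proof (rule bij_betw_imageI)
    show "inj_on (\<lambda>y. {v, y}) {y \<in> V. {v, y} \<in> E}"
      by (auto simp: inj_on_def doubleton_eq_iff)
    have "\<exists>y\<in>V. {v, y} \<in> E \<and> e = {v, y}" if "e \<in> E" "v \<in> e" for e
    proof -
      have "e \<subseteq> V" "card e = 2" using assms that by (auto simp: fin_simple_graph_def)
      then obtain x y where "e = {x, y}" by (auto simp: card_2_iff)
      then show ?thesis using that \<open>e \<subseteq> V\<close> by (auto simp: insert_commute)
    qed
    then show "(\<lambda>y. {v, y}) ` {y \<in> V. {v, y} \<in> E} = {e \<in> E. v \<in> e}"
      by auto
  qed
  then show ?thesis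
    by (rule sum.reindex_bij_betw[symmetric])
qed

lemma load_eq_sum:
  assumes "fin_simple_graph V E" "v \<in> V"
  shows "load E h v = (\<Sum>y\<in>V. if {v, y} \<in> E then h {v, y} else 0)"
proof -
  have "finite V" using assms by (simp add: fin_simple_graph_def)
  then show ?thesis
    using assms by (simp add: load_def sum_incident_edges sum.inter_filter)
qed

lemma degree_delete_edges_eq_sum:
  assumes "fin_simple_graph V E" "v \<in> V - S"
  shows "real (degree (delete_edges E S) v) = (\<Sum>y\<in>V - S. of_bool ({v, y} \<in> E))"
proof -
  have "real (degree (delete_edges E S) v) = load (delete_edges E S) (\<lambda>_. 1) v"
    by (simp add: degree_def load_def)
  also have "\<dots> = (\<Sum>y\<in>V - S. of_bool ({v, y} \<in> E))"
    unfolding load_eq_sum[OF fin_simple_graph_delete[OF assms(1)] assms(2)]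
    using assms(2) by (intro sum.cong) (auto simp: delete_edges_def)
  finally show ?thesis .
qed

section \<open>Optimal weightings and residual directions\<close>

text \<open>Compactness: the admissible weightings form a closed subset of a product of compact
  sets, nonempty because of the zero weighting, and the truncated total load is continuous.\<close>

lemma exists_optimal_load:
  assumes "fin_simple_graph V E"
  obtains h where "\<And>e. e \<in> E \<Longrightarrow> 0 \<le> h e \<and> h e \<le> 1"
    and "\<And>v. v \<in> V \<Longrightarrow> load E h v \<le> real b"
    and "\<And>g. (\<And>e. e \<in> E \<Longrightarrow> 0 \<le> g e \<and> g e \<le> 1) \<Longrightarrow> (\<And>v. v \<in> V \<Longrightarrow> load E g v \<le> real b) \<Longrightarrow>
      (\<Sum>v\<in>V. min (real a) (load E g v)) \<le> (\<Sum>v\<in>V. min (real a) (load E h v))"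
proof -
  \<comment> \<open>Weightings are functions on all sets; pinning the coordinates outside
    \<open>E\<close> to 0 keeps the product compact and changes no load.\<close>
  define B :: "'a set \<Rightarrow> real set" where "B = (\<lambda>e. if e \<in> E then {0..1} else {0})"
  define K where "K = PiE UNIV B \<inter> (\<Inter>v\<in>V. {h. load E h v \<le> real b})"
  have cont: "continuous_on UNIV (\<lambda>h. load E h v)" for v
    unfolding load_def by (intro continuous_on_sum continuous_on_product_coordinates)
  have "compactin (product_topology (\<lambda>_. euclidean) UNIV) (PiE UNIV B)"
    unfolding compactin_PiE by (simp add: B_def)
  then have "compact (PiE UNIV B)"
    by (simp add: euclidean_product_topology)
  moreover have "closed (\<Inter>v\<in>V. {h. load E h v \<le> real b})"
    by (intro closed_INT ballI closed_Collect_le cont continuous_on_const)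
  ultimately have "compact K"
    unfolding K_def by (rule compact_Int_closed)
  moreover have "(\<lambda>_. 0) \<in> K" by (auto simp: K_def B_def load_def)
  then have "K \<noteq> {}" by blast
  moreover have "continuous_on K (\<lambda>h. \<Sum>v\<in>V. min (real a) (load E h v))"
    by (intro continuous_on_sum continuous_on_min continuous_on_const continuous_on_subset[OF cont]) auto
  ultimately obtain h where h: "h \<in> K"
    "\<And>g. g \<in> K \<Longrightarrow> (\<Sum>v\<in>V. min (real a) (load E g v)) \<le> (\<Sum>v\<in>V. min (real a) (load E h v))"
    using continuous_attains_sup[of K] by blast
  show thesis
  proof (rule that)
    show "0 \<le> h e \<and> h e \<le> 1" if "e \<in> E" for e
    proof -
      have "h e \<in> B e" using h(1) by (auto simp: K_def PiE_def Pi_def)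
      then show ?thesis using that by (simp add: B_def)
    qed
    show "load E h v \<le> real b" if "v \<in> V" for v
      using h(1) that by (auto simp: K_def)
    fix g :: "'a set \<Rightarrow> real"
    assume g: "\<And>e. e \<in> E \<Longrightarrow> 0 \<le> g e \<and> g e \<le> 1" "\<And>v. v \<in> V \<Longrightarrow> load E g v \<le> real b"
    let ?g = "\<lambda>e. if e \<in> E then g e else 0"
    have eq: "load E ?g v = load E g v" for v
      unfolding load_def by (intro sum.cong) auto
    have "?g \<in> K" using g eq by (auto simp: K_def B_def)
    from h(2)[OF this] eq
    show "(\<Sum>v\<in>V. min (real a) (load E g v)) \<le> (\<Sum>v\<in>V. min (real a) (load E h v))" by simp
  qed
qed

text \<open>A slack bound survives small steps by continuity, a tight one because \<open>d\<close>
  does not point outwards. The eventual form lets finitely many bounds share one step size.\<close>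

lemma eventually_perturb_le:
  fixes x c d :: real
  assumes "x \<le> c" "x = c \<Longrightarrow> d \<le> 0"
  shows "\<forall>\<^sub>F \<epsilon> in at_right 0. x + \<epsilon> * d \<le> c"
proof (cases "x = c")
  case True
  then show ?thesis
    using assms(2) eventually_at_right_less[of "0::real"]
    by (auto elim!: eventually_mono simp: mult_nonneg_nonpos)
next
  case False
  have "((\<lambda>\<epsilon>. x + \<epsilon> * d) \<longlongrightarrow> x + 0 * d) (at_right 0)"
    by (intro tendsto_intros)
  then have "\<forall>\<^sub>F \<epsilon> in at_right 0. x + \<epsilon> * d < c"
    using False assms(1) by (intro order_tendstoD(2)[where y = "x + 0 * d"]) auto
  then show ?thesis by (rule eventually_mono) simp
qed

lemma eventually_perturb_ge:
  fixes x c d :: real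
  assumes "c \<le> x" "x = c \<Longrightarrow> 0 \<le> d"
  shows "\<forall>\<^sub>F \<epsilon> in at_right 0. c \<le> x + \<epsilon> * d"
  using eventually_perturb_le[of "-x" "-c" "-d"] assms
  by (auto elim!: eventually_mono)

lemma load_add_scaled: "load E (\<lambda>e. h e + \<epsilon> * d e) v = load E h v + \<epsilon> * load E d v"
  by (simp add: load_def sum.distrib sum_distrib_left)

lemma load_indicator_edge:
  assumes "finite E" "{x, y} \<in> E" "x \<noteq> y"
  shows "load E (\<lambda>e. of_bool (e = {x, y})) v = of_bool (v = x) + of_bool (v = y)"
proof -
  have "load E (\<lambda>e. of_bool (e = {x, y})) v = of_bool ({x, y} \<in> {e \<in> E. v \<in> e})"
    unfolding load_def of_bool_def using assms(1)
    by (subst sum.delta) auto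
  then show ?thesis using assms by auto
qed

text \<open>For a weighting of a finite \<open>E\<close> into [0,1], these are the directions in
  which some positive step keeps all weights in [0,1]. Loads are left unconstrained.\<close>

definition residual_dir :: "'a set set \<Rightarrow> ('a set \<Rightarrow> real) \<Rightarrow> ('a set \<Rightarrow> real) \<Rightarrow> bool" where
  "residual_dir E h d \<longleftrightarrow> (\<forall>e\<in>E. (h e = 0 \<longrightarrow> 0 \<le> d e) \<and> (h e = 1 \<longrightarrow> d e \<le> 0))"

text \<open>Finitely many constraints, each tolerating all small steps, admit a common positive
  step. It lowers no truncated load and raises that of \<open>u\<close>, against optimality.\<close>

lemma no_improving_dir:
  assumes fin: "finite V" "finite E"
    and h: "\<And>e. e \<in> E \<Longrightarrow> 0 \<le> h e \<and> h e \<le> 1" "\<And>v. v \<in> V \<Longrightarrow> load E h v \<le> real b"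
    and opt: "\<And>g. (\<And>e. e \<in> E \<Longrightarrow> 0 \<le> g e \<and> g e \<le> 1) \<Longrightarrow> (\<And>v. v \<in> V \<Longrightarrow> load E g v \<le> real b) \<Longrightarrow>
      (\<Sum>v\<in>V. min (real a) (load E g v)) \<le> (\<Sum>v\<in>V. min (real a) (load E h v))"
    and u: "u \<in> V" "load E h u < real a" "0 < load E d u"
    and d: "residual_dir E h d"
    and up: "\<And>v. v \<in> V \<Longrightarrow> 0 < load E d v \<Longrightarrow> load E h v < real b"
    and down: "\<And>v. v \<in> V \<Longrightarrow> load E d v < 0 \<Longrightarrow> real a < load E h v"
  shows False
proof -
  have "\<forall>\<^sub>F \<epsilon> in at_right 0. \<forall>e\<in>E. h e + \<epsilon> * d e \<le> 1"
    using fin h d unfolding residual_dir_def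
    by (intro eventually_ball_finite ballI eventually_perturb_le) auto
  moreover have "\<forall>\<^sub>F \<epsilon> in at_right 0. \<forall>e\<in>E. 0 \<le> h e + \<epsilon> * d e"
    using fin h d unfolding residual_dir_def
    by (intro eventually_ball_finite ballI eventually_perturb_ge) auto
  moreover have "\<forall>\<^sub>F \<epsilon> in at_right 0. \<forall>v\<in>V. load E h v + \<epsilon> * load E d v \<le> real b"
    using fin h up by (intro eventually_ball_finite ballI eventually_perturb_le) force+
  \<comment> \<open>At load at most \<open>a\<close> the bound is tight, but there
    \<open>down\<close> rules out a decrease; above \<open>a\<close> it is slack.\<close>
  moreover have "\<forall>\<^sub>F \<epsilon> in at_right 0. \<forall>v\<in>V.
      min (real a) (load E h v) \<le> load E h v + \<epsilon> * load E d v"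
    using fin down by (intro eventually_ball_finite ballI eventually_perturb_ge) (force simp: min_def)+
  moreover have "\<forall>\<^sub>F \<epsilon> in at_right (0::real). 0 < \<epsilon>"
    by (rule eventually_at_right_less)
  ultimately have "\<forall>\<^sub>F \<epsilon> in at_right (0::real). 0 < \<epsilon> \<and>
      (\<forall>e\<in>E. h e + \<epsilon> * d e \<le> 1) \<and> (\<forall>e\<in>E. 0 \<le> h e + \<epsilon> * d e) \<and>
      (\<forall>v\<in>V. load E h v + \<epsilon> * load E d v \<le> real b) \<and>
      (\<forall>v\<in>V. min (real a) (load E h v) \<le> load E h v + \<epsilon> * load E d v)"
    by eventually_elim auto
  then obtain \<epsilon> where \<epsilon>: "0 < \<epsilon>" "\<forall>e\<in>E. h e + \<epsilon> * d e \<le> 1" "\<forall>e\<in>E. 0 \<le> h e + \<epsilon> * d e"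
      "\<forall>v\<in>V. load E h v + \<epsilon> * load E d v \<le> real b"
      "\<forall>v\<in>V. min (real a) (load E h v) \<le> load E h v + \<epsilon> * load E d v"
    using eventually_happens'[OF trivial_limit_at_right_real] by blast
  let ?g = "\<lambda>e. h e + \<epsilon> * d e"
  have "(\<Sum>v\<in>V. min (real a) (load E h v)) < (\<Sum>v\<in>V. min (real a) (load E ?g v))"
  proof (rule sum_strict_mono_ex1)
    show "\<forall>v\<in>V. min (real a) (load E h v) \<le> min (real a) (load E ?g v)"
      using \<epsilon>(5) by (simp add: load_add_scaled)
    have "0 < \<epsilon> * load E d u" using \<epsilon>(1) u(3) by simp
    then have "min (real a) (load E h u) < min (real a) (load E ?g u)"
      using u(2) unfolding load_add_scaled by (simp add: min_def)
    then show "\<exists>v\<in>V. min (real a) (load E h v) < min (real a) (load E ?g v)"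
      using u(1) by blast
  qed (rule fin)
  moreover have "(\<Sum>v\<in>V. min (real a) (load E ?g v)) \<le> (\<Sum>v\<in>V. min (real a) (load E h v))"
    using \<epsilon> by (intro opt) (auto simp: load_add_scaled)
  ultimately show False by linarith
qed

section \<open>Sufficiency of Anstee's criterion\<close>

text \<open>Makes the criterion for disjoint sets applicable to overlapping sets of reachable vertices.\<close>

lemma sum_degrees_disjointify:
  assumes G: "fin_simple_graph V E" and sub: "X \<subseteq> V" "Y \<subseteq> V"
  shows "(\<Sum>x\<in>X - Y. real (degree (delete_edges E (Y - X)) x)) \<le>
    (\<Sum>x\<in>X. \<Sum>y\<in>V - Y. of_bool ({x, y} \<in> E))"
proof -
  let ?adj = "\<lambda>x y. of_bool ({x, y} \<in> E) :: real"
  have fin: "finite V" "finite X" "finite Y"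
    using G sub by (auto simp: fin_simple_graph_def intro: finite_subset)
  have split: "V - (Y - X) = (V - Y) \<union> (X \<inter> Y)" "X = (X - Y) \<union> (X \<inter> Y)" using sub by auto
  have "(\<Sum>x\<in>X - Y. real (degree (delete_edges E (Y - X)) x))
      = (\<Sum>x\<in>X - Y. \<Sum>y\<in>V - (Y - X). ?adj x y)"
    using sub by (intro sum.cong degree_delete_edges_eq_sum[OF G]) auto
  also have "\<dots> = (\<Sum>x\<in>X - Y. (\<Sum>y\<in>V - Y. ?adj x y) + (\<Sum>y\<in>X \<inter> Y. ?adj x y))"
    unfolding split(1) using fin by (intro sum.cong sum.union_disjoint) auto
  also have "\<dots> = (\<Sum>x\<in>X - Y. \<Sum>y\<in>V - Y. ?adj x y) + (\<Sum>y\<in>X \<inter> Y. \<Sum>x\<in>X - Y. ?adj x y)"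
    unfolding sum.distrib by (subst (2) sum.swap) simp
  \<comment> \<open>Adjacencies between \<open>X - Y\<close> and \<open>X \<inter> Y\<close> are
    recounted from the side of \<open>X \<inter> Y\<close>, where they are among those leading to
    \<open>V - Y\<close>.\<close>
  also have "(\<Sum>y\<in>X \<inter> Y. \<Sum>x\<in>X - Y. ?adj x y) \<le> (\<Sum>y\<in>X \<inter> Y. \<Sum>x\<in>V - Y. ?adj y x)"
    unfolding insert_commute[of _ _ "{}"]
    using fin sub by (intro sum_mono sum_mono2) auto
  also have "(\<Sum>x\<in>X - Y. \<Sum>y\<in>V - Y. ?adj x y) + (\<Sum>y\<in>X \<inter> Y. \<Sum>x\<in>V - Y. ?adj y x)
      = (\<Sum>x\<in>X. \<Sum>y\<in>V - Y. ?adj x y)"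
    using fin by (subst (3) split(2), subst sum.union_disjoint) auto
  finally show ?thesis by simp
qed

text \<open>The load on \<open>X\<close> is computed in two ways: it is below
  \<open>a * card X\<close> because \<open>u\<close> is deficient, yet it equals the number of
  adjacencies from \<open>X\<close> to \<open>V - Y\<close> plus \<open>b * card Y\<close>.\<close>

lemma anstee_fractional_factor:
  assumes G: "fin_simple_graph V E" and ab: "a \<le> b"
    and crit: "\<And>S T. S \<subseteq> V \<Longrightarrow> T \<subseteq> V \<Longrightarrow> S \<inter> T = {} \<Longrightarrow>
      a * card T \<le> b * card S + (\<Sum>v\<in>T. degree (delete_edges E S) v)"
  shows "has_fractional_factor a b V E"
proof -
  have fin: "finite V" "finite E"
    using G fin_simple_graph_finite_edges[OF G] by (auto simp: fin_simple_graph_def)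
  have edge: "x \<in> V \<and> y \<in> V \<and> x \<noteq> y" if "{x, y} \<in> E" for x y
    using G that by (force simp: fin_simple_graph_def card_2_iff)
  obtain h where h: "\<And>e. e \<in> E \<Longrightarrow> 0 \<le> h e \<and> h e \<le> 1" "\<And>v. v \<in> V \<Longrightarrow> load E h v \<le> real b"
    and opt: "\<And>g. (\<And>e. e \<in> E \<Longrightarrow> 0 \<le> g e \<and> g e \<le> 1) \<Longrightarrow> (\<And>v. v \<in> V \<Longrightarrow> load E g v \<le> real b) \<Longrightarrow>
      (\<Sum>v\<in>V. min (real a) (load E g v)) \<le> (\<Sum>v\<in>V. min (real a) (load E h v))"
    using exists_optimal_load[OF G] by blast
  have "real a \<le> load E h u" if u: "u \<in> V" for u
  proof (rule ccontr)
    assume "\<not> real a \<le> load E h u"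
    then have ua: "load E h u < real a" by simp
    \<comment> \<open>\<open>X\<close> and \<open>Y\<close> are the vertices reached from \<open>u\<close> by alternating walks of even and odd length.
      Both may contain the same vertex.\<close>
    define X where "X = {x \<in> V. \<exists>d. residual_dir E h d \<and>
      (\<forall>v. load E d v = of_bool (v = u) - of_bool (v = x))}"
    define Y where "Y = {y \<in> V. \<exists>d. residual_dir E h d \<and>
      (\<forall>v. load E d v = of_bool (v = u) + of_bool (v = y))}"
    have sub: "X \<subseteq> V" "Y \<subseteq> V" by (auto simp: X_def Y_def)
    then have finXY: "finite X" "finite Y" using fin by (auto intro: finite_subset)
    have uX: "u \<in> X"
      using u by (auto simp: X_def residual_dir_def load_def intro!: exI[of _ "\<lambda>_. 0"])
    have XY: "y \<in> Y" if "x \<in> X" and e: "{x, y} \<in> E" "h {x, y} \<noteq> 1" for x y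
    proof -
      obtain d where d: "residual_dir E h d" "\<And>v. load E d v = of_bool (v = u) - of_bool (v = x)"
        using \<open>x \<in> X\<close> by (auto simp: X_def)
      \<comment> \<open>Raising the weight of this edge cancels the loss at \<open>x\<close> and
        moves a gain to \<open>y\<close>; weight below 1 keeps the direction residual.\<close>
      let ?d = "\<lambda>e. d e + 1 * of_bool (e = {x, y})"
      have "residual_dir E h ?d" using d(1) e by (auto simp: residual_dir_def)
      moreover have "load E ?d v = of_bool (v = u) + of_bool (v = y)" for v
        unfolding load_add_scaled using edge[OF e(1)]
        by (subst load_indicator_edge[OF fin(2) e(1)]) (auto simp: d(2))
      ultimately show ?thesis using edge[OF e(1)] unfolding Y_def by blast
    qed
    have YX: "x \<in> X" if "y \<in> Y" and e: "{x, y} \<in> E" "h {x, y} \<noteq> 0" for x y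
    proof -
      obtain d where d: "residual_dir E h d" "\<And>v. load E d v = of_bool (v = u) + of_bool (v = y)"
        using \<open>y \<in> Y\<close> by (auto simp: Y_def)
      \<comment> \<open>Dually, lowering an edge of positive weight cancels the gain at
        \<open>y\<close> and moves a loss to \<open>x\<close>.\<close>
      let ?d = "\<lambda>e. d e + (- 1) * of_bool (e = {x, y})"
      have "residual_dir E h ?d" using d(1) e by (auto simp: residual_dir_def)
      moreover have "load E ?d v = of_bool (v = u) - of_bool (v = x)" for v
        unfolding load_add_scaled using edge[OF e(1)]
        by (subst load_indicator_edge[OF fin(2) e(1)]) (auto simp: d(2))
      ultimately show ?thesis using edge[OF e(1)] unfolding X_def by blast
    qed
    note improve = no_improving_dir[OF fin h opt u ua]
    \<comment> \<open>Otherwise both \<open>u\<close> and \<open>y\<close> could gain load. The case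
      \<open>y = u\<close>, with a gain of 2, is included.\<close>
    have Yb: "load E h y = real b" if "y \<in> Y" for y
    proof (rule ccontr)
      assume "load E h y \<noteq> real b"
      then have yb: "load E h y < real b" using h(2) that sub by force
      obtain d where d: "residual_dir E h d" "\<And>v. load E d v = of_bool (v = u) + of_bool (v = y)"
        using \<open>y \<in> Y\<close> by (auto simp: Y_def)
      show False
      proof (rule improve[of d])
        fix v assume "0 < load E d v"
        then have "v = u \<or> v = y" by (auto simp: d(2) of_bool_def split: if_splits)
        then show "load E h v < real b" using ua ab yb by auto
      qed (use d in \<open>auto simp: of_bool_def split: if_splits\<close>)
    qed
    \<comment> \<open>Otherwise \<open>x\<close> could pass some of its excess to
      \<open>u\<close>.\<close>
    have Xa: "load E h x \<le> real a" if "x \<in> X" for x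
    proof (rule ccontr)
      assume xa: "\<not> load E h x \<le> real a"
      obtain d where d: "residual_dir E h d" "\<And>v. load E d v = of_bool (v = u) - of_bool (v = x)"
        using \<open>x \<in> X\<close> by (auto simp: X_def)
      show False
      proof (rule improve[of d])
        show "0 < load E d u" using xa ua by (auto simp: d(2))
        fix v
        show "load E h v < real b" if "0 < load E d v"
        proof -
          have "v = u" using that by (auto simp: d(2) of_bool_def split: if_splits)
          then show ?thesis using ua ab by auto
        qed
        show "real a < load E h v" if "load E d v < 0"
        proof -
          have "v = x" using that by (auto simp: d(2) of_bool_def split: if_splits)
          then show ?thesis using xa by auto
        qed
      qed (use d(1) in auto)
    qed
    let ?w = "\<lambda>x y. if {x, y} \<in> E then h {x, y} else 0"
    let ?adj = "\<lambda>x y. of_bool ({x, y} \<in> E) :: real"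
    have "(\<Sum>x\<in>X. load E h x) = (\<Sum>x\<in>X. (\<Sum>y\<in>V - Y. ?w x y) + (\<Sum>y\<in>Y. ?w x y))"
    proof (intro sum.cong refl)
      fix x assume "x \<in> X"
      then show "load E h x = (\<Sum>y\<in>V - Y. ?w x y) + (\<Sum>y\<in>Y. ?w x y)"
        using load_eq_sum[OF G, of x h] sub sum.subset_diff[OF sub(2) fin(1), of "?w x"] by auto
    qed
    also have "\<dots> = (\<Sum>x\<in>X. \<Sum>y\<in>V - Y. ?w x y) + (\<Sum>y\<in>Y. \<Sum>x\<in>X. ?w x y)"
      unfolding sum.distrib by (subst (2) sum.swap) simp
    \<comment> \<open>By \<open>XY\<close>, every edge from \<open>X\<close> to a vertex outside
      \<open>Y\<close> has weight 1.\<close>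
    also have "(\<Sum>x\<in>X. \<Sum>y\<in>V - Y. ?w x y) = (\<Sum>x\<in>X. \<Sum>y\<in>V - Y. ?adj x y)"
      using XY by (intro sum.cong refl) auto
    also have "(\<Sum>y\<in>Y. \<Sum>x\<in>X. ?w x y) = (\<Sum>y\<in>Y. real b)"
    proof (intro sum.cong refl)
      fix y assume y: "y \<in> Y"
      \<comment> \<open>By \<open>YX\<close>, all positive weight at \<open>y\<close> comes from
        \<open>X\<close>.\<close>
      have "(\<Sum>x\<in>X. ?w x y) = (\<Sum>x\<in>V. ?w x y)"
        using YX[OF y] sub fin by (intro sum.mono_neutral_left) auto
      also have "\<dots> = load E h y"
        using load_eq_sum[OF G, of y h] y sub by (simp only: insert_commute[of y] subsetD)
      finally show "(\<Sum>x\<in>X. ?w x y) = real b" using Yb[OF y] by simp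
    qed
    finally have sum_load: "(\<Sum>x\<in>X. load E h x) =
        (\<Sum>x\<in>X. \<Sum>y\<in>V - Y. ?adj x y) + real b * card Y" by simp
    have "(\<Sum>x\<in>X. load E h x) < (\<Sum>x\<in>X. real a)"
      using Xa ua uX finXY by (intro sum_strict_mono_ex1) auto
    then have lt: "(\<Sum>x\<in>X. \<Sum>y\<in>V - Y. ?adj x y) + real b * card Y < real a * card X"
      using sum_load by (simp add: mult.commute)
    \<comment> \<open>The criterion is applied to \<open>Y - X\<close> and \<open>X - Y\<close>.
      Dropping the common vertices is harmless: each counts \<open>a\<close> on one side and
      \<open>b\<close> \<ge> \<open>a\<close> on the other.\<close>
    have "real (a * card (X - Y)) \<le>
        real (b * card (Y - X) + (\<Sum>v\<in>X - Y. degree (delete_edges E (Y - X)) v))"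
      using sub by (subst of_nat_le_iff, intro crit) auto
    also have "\<dots> \<le> real b * card (Y - X) + (\<Sum>x\<in>X. \<Sum>y\<in>V - Y. ?adj x y)"
      using sum_degrees_disjointify[OF G sub] by simp
    finally have "real a * card (X - Y) \<le> real b * card (Y - X) + (\<Sum>x\<in>X. \<Sum>y\<in>V - Y. ?adj x y)"
      by simp
    moreover have "card X = card (X - Y) + card (X \<inter> Y)" "card Y = card (Y - X) + card (X \<inter> Y)"
      using finXY card_Diff_subset_Int[of X Y] card_Diff_subset_Int[of Y X]
        card_mono[of X "X \<inter> Y"] card_mono[of Y "X \<inter> Y"] by (auto simp: Int_commute)
    moreover have "real a * card (X \<inter> Y) \<le> real b * card (X \<inter> Y)"
      using ab by (simp add: mult_right_mono)
    ultimately show False using lt by (simp add: algebra_simps)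
  qed
  then show ?thesis
    using h unfolding has_fractional_factor_def load_def by blast
qed

section \<open>Degree and edge counts under vertex deletion\<close>

lemma fin_simple_graph_edgeE:
  assumes "fin_simple_graph V E" "e \<in> E" "x \<in> e"
  obtains y where "e = {x, y}" "x \<noteq> y" "x \<in> V" "y \<in> V"
proof -
  have "e \<subseteq> V" "card e = 2" using assms by (auto simp: fin_simple_graph_def)
  then show ?thesis using assms(3) that by (auto simp: card_2_iff insert_commute)
qed

lemma degree_le_degree_delete_edges:
  assumes G: "fin_simple_graph V E" and v: "v \<notin> S" and S: "finite S"
  shows "degree E v \<le> degree (delete_edges E S) v + card S"
proof -
  have "finite E" using G by (rule fin_simple_graph_finite_edges)
  have "{e \<in> E. v \<in> e} \<subseteq> {e \<in> delete_edges E S. v \<in> e} \<union> (\<lambda>x. {v, x}) ` S"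
  proof
    fix e assume e: "e \<in> {e \<in> E. v \<in> e}"
    then obtain y where "e = {v, y}" using fin_simple_graph_edgeE[OF G] by blast
    then show "e \<in> {e \<in> delete_edges E S. v \<in> e} \<union> (\<lambda>x. {v, x}) ` S"
      using e v by (auto simp: delete_edges_def)
  qed
  then have "card {e \<in> E. v \<in> e} \<le> card ({e \<in> delete_edges E S. v \<in> e} \<union> (\<lambda>x. {v, x}) ` S)"
    using \<open>finite E\<close> S by (intro card_mono) (auto simp: delete_edges_def)
  also have "\<dots> \<le> card {e \<in> delete_edges E S. v \<in> e} + card ((\<lambda>x. {v, x}) ` S)"
    by (rule card_Un_le)
  also have "\<dots> \<le> degree (delete_edges E S) v + card S"
    unfolding degree_def using card_image_le[OF S] by (intro add_left_mono)
  finally show ?thesis by (simp add: degree_def)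
qed

text \<open>An independent set spans no edge, so each lost edge joins \<open>I\<close> to
  \<open>V - I\<close>.\<close>

lemma card_edges_le_delete_independent:
  assumes G: "fin_simple_graph V E" and I: "independent_set V E I"
  shows "card E \<le> card (delete_edges E I) + card I * card (V - I)"
proof -
  have fin: "finite E" "finite V" "finite I"
    using fin_simple_graph_finite_edges[OF G] G I
    by (auto simp: fin_simple_graph_def independent_set_def intro: finite_subset)
  have "E \<subseteq> delete_edges E I \<union> (\<lambda>(x, y). {x, y}) ` (I \<times> (V - I))"
  proof
    fix e assume e: "e \<in> E"
    show "e \<in> delete_edges E I \<union> (\<lambda>(x, y). {x, y}) ` (I \<times> (V - I))"
    proof (cases "e \<inter> I = {}")
      case True
      then show ?thesis using e by (simp add: delete_edges_def)
    next
      case False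
      then obtain x where x: "x \<in> e" "x \<in> I" by blast
      then obtain y where "e = {x, y}" "y \<in> V" using fin_simple_graph_edgeE[OF G e] by metis
      moreover then have "y \<notin> I" using I x e by (auto simp: independent_set_def)
      ultimately show ?thesis using x by auto
    qed
  qed
  then have "card E \<le> card (delete_edges E I \<union> (\<lambda>(x, y). {x, y}) ` (I \<times> (V - I)))"
    using fin by (intro card_mono) (auto simp: delete_edges_def)
  also have "\<dots> \<le> card (delete_edges E I) + card ((\<lambda>(x, y). {x, y}) ` (I \<times> (V - I)))"
    by (rule card_Un_le)
  also have "card ((\<lambda>(x, y). {x, y}) ` (I \<times> (V - I))) \<le> card (I \<times> (V - I))"
    using fin by (intro card_image_le) auto
  finally show ?thesis by (simp add: card_cartesian_product)
qed

text \<open>An edge avoids \<open>T\<close>, or meets both \<open>S\<close> and \<open>T\<close>, or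
  meets \<open>T\<close> and avoids \<open>S\<close>. The degree sum counts the last kind, possibly
  twice, which an upper bound allows.\<close>

lemma card_edges_le_split:
  assumes G: "fin_simple_graph V E" and sub: "S \<subseteq> V" "T \<subseteq> V"
    and dis: "S \<inter> T = {}"
  shows "card E \<le> ((card V - card T) choose 2) + card S * card T
    + (\<Sum>v\<in>T. degree (delete_edges E S) v)"
proof -
  have fin: "finite E" "finite V" "finite S" "finite T"
    using fin_simple_graph_finite_edges[OF G] G sub
    by (auto simp: fin_simple_graph_def intro: finite_subset)
  let ?A = "{e. e \<subseteq> V - T \<and> card e = 2}"
  let ?B = "(\<lambda>(x, y). {x, y}) ` (S \<times> T)"
  let ?C = "\<Union>v\<in>T. {e \<in> delete_edges E S. v \<in> e}"
  have finABC: "finite ?A" "finite ?B" "finite ?C"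
    using fin by (auto simp: delete_edges_def intro: finite_subset[of _ "Pow V"])
  have "E \<subseteq> ?A \<union> ?B \<union> ?C"
  proof
    fix e assume e: "e \<in> E"
    show "e \<in> ?A \<union> ?B \<union> ?C"
    proof (cases "e \<inter> T = {}")
      case True
      then show ?thesis using e G by (auto simp: fin_simple_graph_def)
    next
      case False
      then obtain x where x: "x \<in> e" "x \<in> T" by blast
      then obtain y where y: "e = {x, y}" using fin_simple_graph_edgeE[OF G e] by metis
      show ?thesis
      proof (cases "e \<inter> S = {}")
        case True
        then show ?thesis using e x by (auto simp: delete_edges_def)
      next
        case False
        then obtain z where z: "z \<in> e" "z \<in> S" by blast
        have "e = {z, x}" using x y z dis by auto
        then show ?thesis using x z by auto
      qed
    qed
  qed
  then have "card E \<le> card (?A \<union> ?B \<union> ?C)"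
    using finABC by (intro card_mono) auto
  also have "\<dots> \<le> card ?A + card ?B + card ?C"
    using card_Un_le[of "?A \<union> ?B" ?C] card_Un_le[of ?A ?B] by linarith
  also have "card ?A = (card V - card T) choose 2"
    using n_subsets[of "V - T" 2] fin sub by (simp add: card_Diff_subset)
  also have "card ?B \<le> card S * card T"
    using card_image_le[of "S \<times> T" "\<lambda>(x, y). {x, y}"] fin by (simp add: card_cartesian_product)
  also have "card ?C \<le> (\<Sum>v\<in>T. degree (delete_edges E S) v)"
    unfolding degree_def by (rule card_UN_le[OF fin(4)])
  finally show ?thesis by simp
qed

section \<open>Arithmetic of the edge bound\<close>

text \<open>Here \<open>k = t - b - 1\<close> and \<open>M = m - b - 1\<close>. For small \<open>k\<close> the bound \<open>s \<le> a + k\<close> suffices, for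
  large \<open>k\<close> the bound \<open>s \<le> M - k\<close>.\<close>

lemma edge_bound_arith:
  fixes a b k s M :: int
  assumes a: "1 \<le> a" "a \<le> b" and k: "0 \<le> k" and M: "4 * a + 3 * b + 6 \<le> M"
    and s: "s \<le> a + k" "s \<le> M - k"
  shows "2 * s * (k + 1) + 2 * a * (k - 1) + k * (k + 1) \<le> 2 * k * M"
\<comment> \<open>With \<open>s\<close> replaced by \<open>a + k\<close>, the claim becomes
  \<open>k\<close> times this condition.\<close>
proof (cases "3 * (k + 1) \<le> 2 * (M - 2 * a)")
  case True
  have "s * (k + 1) \<le> (a + k) * (k + 1)" using s k by (intro mult_right_mono) auto
  moreover have "k * (3 * (k + 1)) \<le> k * (2 * (M - 2 * a))"
    using True k by (intro mult_left_mono)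
  ultimately show ?thesis by (simp add: algebra_simps)
next
  case False
  have "s * (k + 1) \<le> (M - k) * (k + 1)" using s k by (intro mult_right_mono) auto
  then have "s * k + s \<le> M * k + M - k * k - k" by (simp add: algebra_simps)
  \<comment> \<open>The failed condition, the bound on \<open>M\<close> and \<open>b\<close> \<ge>
    \<open>a\<close> give \<open>10 * a + 10 \<le> 3 * k\<close>.\<close>
  moreover have "k * (10 * a + 10) \<le> k * (3 * k)"
    using False M a k by (intro mult_left_mono) auto
  then have "10 * (a * k) + 10 * k \<le> 3 * (k * k)" by (simp add: algebra_simps)
  moreover have k7: "7 \<le> k" using False M a by (simp add: algebra_simps)
  moreover have "a * 7 \<le> a * k" using k7 a by (intro mult_left_mono) auto
  moreover have "2 * M < 3 * k + 4 * a + 3" using False by simp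
  ultimately have "2 * (s * k) + 2 * s + 2 * (a * k) - 2 * a + k * k + k \<le> 2 * (M * k)"
    using k7 a by linarith
  then show ?thesis by (simp add: algebra_simps)
qed

lemma two_choose_two_int: "2 * int (m choose 2) = int m * (int m - 1)"
proof -
  have "2 * (m choose 2) = m * (m - 1)"
    unfolding choose_two by (rule dvd_mult_div_cancel) (cases "even m"; simp)
  then have "2 * int (m choose 2) = int (m * (m - 1))" by (metis of_nat_mult of_nat_numeral)
  then show ?thesis by (cases m) (auto simp: algebra_simps)
qed

text \<open>Chaining \<open>lower\<close>, \<open>upper\<close> and \<open>D\<close>, then doubling,
  leaves exactly the negation of \<open>edge_bound_arith\<close>: the terms in \<open>b * s\<close>
  and \<open>a * (b + 1)\<close> cancel.\<close>

lemma edge_bound_contradiction: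
  fixes a b m s t e D :: nat
  assumes a: "1 \<le> a" "a \<le> b" and m: "4 * a + 4 * b + 7 \<le> m"
    and t: "b + 1 \<le> t" and st: "s + t \<le> m" and D: "b * s + D < a * t"
    and lower: "((m - b - 1) choose 2) + a * (b + 1) + a \<le> e"
    and upper: "e \<le> ((m - t) choose 2) + s * t + D"
  shows False
proof -
  obtain k where k: "t = b + 1 + k" using t le_Suc_ex by metis
  define M where "M = int m - int b - 1"
  \<comment> \<open>Since \<open>a\<close> \<le> \<open>b\<close>, the factor \<open>b\<close> can
    be cancelled to give \<open>s \<le> a + k\<close>; the other bound \<open>s \<le> M - k\<close>
    restates \<open>st\<close>.\<close>
  have "b * s < b * (a + k + 1)"
  proof -
    have "b * s < a * (b + 1 + k)" using D k by simp
    also have "a * (b + 1 + k) \<le> b * (a + k + 1)"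
      using a(2) mult_right_mono[OF a(2), of "1 + k"] by (simp add: algebra_simps)
    finally show ?thesis .
  qed
  then have "s < a + k + 1" by (simp only: mult_less_cancel1)
  then have "s \<le> a + k" by simp
  then have bound: "2 * int s * (int k + 1) + 2 * int a * (int k - 1) + int k * (int k + 1) \<le> 2 * int k * M"
    using a m st k by (intro edge_bound_arith[of _ "int b"]) (auto simp: M_def)
  define P Q where "P = (m - b - 1) choose 2" and "Q = (m - t) choose 2"
  have "int (m - b - 1) = M" "int (m - t) = M - int k" using m st k by (auto simp: M_def)
  then have C: "2 * int P = M * (M - 1)" "2 * int Q = (M - int k) * (M - int k - 1)"
    by (simp_all add: two_choose_two_int P_def Q_def)
  have "P + a * (b + 1) + a + b * s < Q + s * t + a * t"
    using lower upper D unfolding P_def Q_def by linarith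
  then have "int (P + a * (b + 1) + a + b * s) < int (Q + s * t + a * t)"
    by (simp only: of_nat_less_iff)
  then have "2 * int P + 2 * (int a * (int b + 1) + int a + int b * int s)
      < 2 * int Q + 2 * (int s * int t + int a * int t)"
    by (simp add: algebra_simps)
  then show False
    using bound unfolding C k by (simp add: algebra_simps)
qed

section \<open>The criterion verified for the graph without the independent set\<close>

theorem theorem1p9:
  fixes V :: "'a set" and E :: "'a set set" and a b r n :: nat
  assumes "r \<ge> 1" and "a \<ge> 1" and "b \<ge> a"
    and "fin_simple_graph V E" and "connected_graph V E"
    and "card V = n" and "n \<ge> 4 * (a + b + r + 1)"
    and "min_degree V E \<ge> a + r"
    and "card E \<ge> ((n - r - b - 1) choose 2) + r * (n - r) + a * (b + 1) + a"
  shows "fractional_ID_factor_critical r a b V E"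
  unfolding fractional_ID_factor_critical_def
proof (intro allI impI, elim conjE)
  fix I assume I: "independent_set V E I" "card I = r"
  let ?V = "V - I" and ?E = "delete_edges E I"
  have finV: "finite V" and "I \<subseteq> V"
    using assms(4) I by (auto simp: fin_simple_graph_def independent_set_def)
  then have finI: "finite I" by (rule finite_subset[rotated])
  have cardV: "card ?V = n - r"
    using \<open>I \<subseteq> V\<close> finI I assms(6) by (simp add: card_Diff_subset)
  have G: "fin_simple_graph ?V ?E" using assms(4) by (rule fin_simple_graph_delete)
  have edges: "((n - r - b - 1) choose 2) + a * (b + 1) + a \<le> card ?E"
    using card_edges_le_delete_independent[OF assms(4) I(1)] assms(9) cardV I(2) by simp
  have deg: "a \<le> degree ?E v" if "v \<in> ?V" for v
  proof -
    have "min_degree V E \<le> degree E v"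
      unfolding min_degree_def using that finV by (intro Min_le) auto
    then show ?thesis
      using degree_le_degree_delete_edges[OF assms(4), of v I] that finI I(2) assms(8) by simp
  qed
  show "has_fractional_factor a b ?V ?E"
  proof (rule anstee_fractional_factor[OF G assms(3)], rule ccontr)
    fix S T assume ST: "S \<subseteq> ?V" "T \<subseteq> ?V" "S \<inter> T = {}"
    let ?D = "\<Sum>v\<in>T. degree (delete_edges ?E S) v"
    assume "\<not> a * card T \<le> b * card S + ?D"
    then have D: "b * card S + ?D < a * card T" by simp
    have finST: "finite S" "finite T" using ST finV by (auto intro: finite_subset)
    have "a * card T \<le> ?D + card S * card T"
    proof -
      have "(\<Sum>v\<in>T. a) \<le> (\<Sum>v\<in>T. degree (delete_edges ?E S) v + card S)"
      proof (rule sum_mono)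
        fix v assume "v \<in> T"
        then show "a \<le> degree (delete_edges ?E S) v + card S"
          using deg[of v] degree_le_degree_delete_edges[OF G, of v S] ST finST by force
      qed
      then show ?thesis by (simp add: sum.distrib mult.commute)
    qed
    \<comment> \<open>The degree sum cancels between both bounds; strictness forces \<open>S\<close>
      to be nonempty, so \<open>card S\<close> cancels as well.\<close>
    then have "b * card S < card T * card S" using D by (simp only: mult.commute[of "card T"])
    then have t: "b + 1 \<le> card T" by simp
    have "card (S \<union> T) \<le> card ?V" using ST finV by (intro card_mono) auto
    then have st: "card S + card T \<le> n - r"
      using card_Un_disjoint[OF finST ST(3)] cardV by simp
    \<comment> \<open>The order bound leaves \<open>3 * r + 4\<close>, at least 7 as
      \<open>r\<close> \<ge> 1, beyond \<open>4 * a + 4 * b\<close>.\<close>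
    have m: "4 * a + 4 * b + 7 \<le> n - r" using assms(1,7) by simp
    show False
      using edge_bound_contradiction[OF assms(2,3) m t st D edges]
        card_edges_le_split[OF G ST] cardV by simp
  qed
qed

end
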